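(* For every integer $n\ge 3$, the expected number $E_3(n)$ of rolls of a fair $n$-sided die until three consecutive (strictly) increasing values are seen satisfies \[E_3(n)\in\mathbb{N} \iff n=3.\]
   Context: $E_3(n)$: let $X_1,X_2,\dots$ be i.i.d. uniform on $\{1,\dots,n\}$ and let $T$ be the least $t\ge 3$ with $X_{t-2}<X_{t-1}<X_t$; then $E_3(n)=\mathbb{E}[T]$. *)

theory Defs
  imports "HOL-Probability.Probability"
begin

text \<open>The rolls are indexed from 1; \<open>X 0\<close> is unconstrained and never used.\<close>

definition iid_die_rolls :: "'a measure \<Rightarrow> nat \<Rightarrow> (nat \<Rightarrow> 'a \<Rightarrow> nat) \<Rightarrow> bool" where
  "iid_die_rolls M n X \<longleftrightarrow>
     prob_space M \<and>
     prob_space.indep_vars M (\<lambda>_. count_space UNIV) X {1..} \<and>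
     (\<forall>i\<ge>1. distr M (count_space UNIV) (X i) = measure_pmf (pmf_of_set {1..n}))"

definition three_increasing_at :: "(nat \<Rightarrow> nat) \<Rightarrow> nat \<Rightarrow> bool" where
  "three_increasing_at x t \<longleftrightarrow> 3 \<le> t \<and> x (t - 2) < x (t - 1) \<and> x (t - 1) < x t"

text \<open>The waiting time is \<open>\<infinity>\<close> on outcomes where the pattern never occurs.\<close>

definition waiting_time :: "(nat \<Rightarrow> nat) \<Rightarrow> enat" where
  "waiting_time x =
     (if \<exists>t. three_increasing_at x t then enat (LEAST t. three_increasing_at x t) else \<infinity>)"

text \<open>The expectation is taken in \<open>[0, \<infinity>]\<close>, so that no integrability has to be presupposed:
  a divergent expectation would be \<open>\<infinity>\<close>, which is not a natural number.\<close>

definition expected_waiting_time :: "'a measure \<Rightarrow> (nat \<Rightarrow> 'a \<Rightarrow> nat) \<Rightarrow> ennreal" where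
  "expected_waiting_time M X =
     (\<integral>\<^sup>+ \<omega>. ennreal_of_enat (waiting_time (\<lambda>i. X i \<omega>)) \<partial>M)"

end

theory Submission
  imports Defs
begin

text \<open>
  Write \<open>T\<close> for the waiting time, and let \<open>q m = (n choose m) / n ^ m\<close>, the probability that \<open>m\<close>
  given consecutive rolls increase. The proof rests on the closed form
  \<open>E[T] = 1 / (\<Sum>j\<ge>1. q (3 * j) - q (3 * j + 1))\<close>
  (\<open>expected_waiting_time_eq_inverse_gap_sum\<close>) and on elementary estimates of this sum.

  For the closed form, suppose that \<open>T > s\<close> and that the \<open>m \<ge> 1\<close> rolls after time \<open>s\<close> increase.
  Follow the increasing run that contains roll \<open>s + 1\<close> back to where it starts. As \<open>T > s\<close>, it
  starts after \<open>s\<close>, \<open>s - 1\<close> or \<open>s - 2\<close> rolls, and then it shows at least \<open>m\<close>, \<open>m + 1\<close> or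
  \<open>m + 2\<close> increasing rolls. Conversely, each of these three disjoint events implies \<open>T > s\<close>,
  since at most two rolls of the new run occur up to time \<open>s\<close>. Let \<open>D m\<close> be the sum over \<open>s\<close> of the
  probabilities that \<open>T > s\<close>, a new run starts right after time \<open>s\<close>, and its first \<open>m\<close> rolls
  increase. As \<open>E[T]\<close> is the sum over \<open>s\<close> of the probabilities of \<open>T > s\<close>, independence gives
  \<open>E[T] * q m = D m + D (m + 1) + D (m + 2)\<close>
  (\<open>suminf_survival_mult_rise_prob\<close>). Subtracting this for \<open>m = 3 * j + 1\<close> from \<open>m = 3 * j\<close> leaves
  \<open>D (3 * j) - D (3 * j + 3)\<close>, and the sum over \<open>j\<close> telescopes to \<open>D 3\<close>. For \<open>m = 3\<close> the event
  says \<open>T = s + 3\<close>, so \<open>D 3\<close> is the probability that \<open>T\<close> is finite, which is \<open>1\<close>.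

  For the estimates, each \<open>q (3 * j) - q (3 * j + 1)\<close> turns out to be nonnegative and increasing
  in \<open>n\<close>, so \<open>E[T]\<close> decreases in \<open>n\<close>. It is \<open>27\<close> for \<open>n = 3\<close> and about \<open>17.07\<close> for
  \<open>n = 4\<close>, and tends to about \<open>7.92\<close>. By monotonicity it suffices to look at the few \<open>n\<close> where
  \<open>E[T]\<close> jumps over an integer; it never hits one (\<open>gap_sum_between_unit_fractions\<close>).
\<close>

section \<open>The reciprocal of the expectation\<close>

definition rise_prob :: "nat \<Rightarrow> nat \<Rightarrow> real" where
  "rise_prob n m = real (n choose m) / real n ^ m"

definition gap :: "nat \<Rightarrow> nat \<Rightarrow> real" where
  "gap n j = rise_prob n (3 * j) - rise_prob n (3 * j + 1)"

definition gap_sum :: "nat \<Rightarrow> real" where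
  "gap_sum n = (\<Sum>j = 1..n. gap n j)"

lemma rise_prob_0 [simp]: "rise_prob n 0 = 1"
  by (simp add: rise_prob_def)

lemma rise_prob_eq_0: "n < m \<Longrightarrow> rise_prob n m = 0"
  by (simp add: rise_prob_def binomial_eq_0)

lemma rise_prob_nonneg: "0 \<le> rise_prob n m"
  by (simp add: rise_prob_def)

lemma rise_prob_Suc:
  assumes "n > 0"
  shows "rise_prob n (Suc m) = rise_prob n m * (1 - real m / real n) / (real m + 1)"
proof (cases "m \<le> n")
  case True
  have "Suc m * (n choose Suc m) = (n - m) * (n choose m)"
    by (metis binomial_absorb_comp binomial_absorption)
  then have "real (Suc m) * real (n choose Suc m) = real (n - m) * real (n choose m)"
    by (metis of_nat_mult)
  then have "real (n choose Suc m) = (real n - real m) * real (n choose m) / (real m + 1)"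
    using True by (simp add: field_simps)
  moreover have "1 - real m / real n = (real n - real m) / real n"
    using assms by (simp add: field_simps)
  ultimately show ?thesis
    by (simp add: rise_prob_def mult.commute)
next
  case False
  then show ?thesis by (simp add: rise_prob_eq_0)
qed

lemma rise_prob_le: "n > 0 \<Longrightarrow> rise_prob n m \<le> 1 / fact m"
proof (induction m)
  case (Suc m)
  have "rise_prob n m * (1 - real m / real n) \<le> rise_prob n m * 1"
    by (intro mult_left_mono) (auto simp: rise_prob_nonneg)
  also have "\<dots> \<le> 1 / fact m" using Suc by simp
  finally have "rise_prob n m * (1 - real m / real n) / (real m + 1) \<le> 1 / fact m / (real m + 1)"
    by (intro divide_right_mono) auto
  then show ?case using Suc.prems by (simp add: rise_prob_Suc ac_simps)
qed simp

text \<open>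
  The alternating difference becomes a manifestly nonnegative product. The weight \<open>1 + 1 / n\<close> decreases in \<open>n\<close>,
  and is kept next to \<open>rise_prob\<close> because only their product is monotone for a visible reason.
\<close>
lemma gap_eq:
  assumes "n > 0"
  shows "gap n j = 3 * real j / (3 * real j + 1) * (rise_prob n (3 * j) * (1 + 1 / real n))"
proof -
  have *: "r - r * (1 - a / b) / (a + 1) = a / (a + 1) * (r * (1 + 1 / b))"
    if "0 \<le> a" "0 < b" for a b r :: real
    using that by (simp add: divide_simps) (simp add: algebra_simps)
  show ?thesis
    using assms *[of "3 * real j" "real n" "rise_prob n (3 * j)"]
    by (simp add: gap_def rise_prob_Suc)
qed

lemma gap_nonneg: "n > 0 \<Longrightarrow> 0 \<le> gap n j"
  by (simp add: gap_eq rise_prob_nonneg)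

lemma gap_le: "n > 0 \<Longrightarrow> gap n j \<le> 1 / fact (3 * j)"
  using rise_prob_le[of n "3 * j"] rise_prob_nonneg[of n "3 * j + 1"] by (simp add: gap_def)

text \<open>
  For \<open>m \<ge> 2\<close> the product \<open>rise_prob n m * (1 + 1 / n)\<close> is
  \<open>(1 - 1 / n\<^sup>2) * (1 - 2 / n) * \<dots> * (1 - (m - 1) / n) / m!\<close>: the factor \<open>1 - 1 / n\<close> absorbs the
  decreasing weight, and then every factor increases with \<open>n\<close>. A negative factor occurs only for
  \<open>n < m\<close>, where another factor vanishes.
\<close>
lemma rise_prob_weighted_mono:
  assumes "0 < n" "n \<le> n'"
  shows "2 \<le> m \<Longrightarrow> rise_prob n m * (1 + 1 / real n) \<le> rise_prob n' m * (1 + 1 / real n')"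
proof (induction m rule: dec_induct)
  case base
  have *: "rise_prob k 2 * (1 + 1 / real k) = (1 - 1 / real k ^ 2) / 2" if "k > 0" for k
    using that by (simp add: numeral_2_eq_2 rise_prob_Suc field_simps)
  have "1 / real n' ^ 2 \<le> 1 / real n ^ 2"
    using assms by (intro divide_left_mono power_mono mult_pos_pos) auto
  then show ?case using assms by (simp add: *)
next
  case (step m)
  show ?case
  proof (cases "m \<le> n")
    case True
    have "real m / real n' \<le> real m / real n"
      using assms by (intro divide_left_mono mult_pos_pos) auto
    moreover have "real m / real n \<le> 1" using True assms by simp
    ultimately have "(rise_prob n m * (1 + 1 / real n)) * ((1 - real m / real n) / (real m + 1))
        \<le> (rise_prob n' m * (1 + 1 / real n')) * ((1 - real m / real n') / (real m + 1))"
      by (intro mult_mono[OF step.IH] divide_right_mono) (auto simp: rise_prob_nonneg)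
    then show ?thesis using assms by (simp add: rise_prob_Suc ac_simps)
  next
    case False
    then show ?thesis by (simp add: rise_prob_eq_0 rise_prob_nonneg)
  qed
qed

lemma gap_mono:
  assumes "0 < n" "n \<le> n'" "0 < j"
  shows "gap n j \<le> gap n' j"
  using assms rise_prob_weighted_mono[of n n' "3 * j"]
  by (simp add: gap_eq mult_left_mono del: times_divide_eq_left)

lemma gap_sum_mono:
  assumes "0 < n" "n \<le> n'"
  shows "gap_sum n \<le> gap_sum n'"
proof -
  have "gap_sum n \<le> (\<Sum>j = 1..n. gap n' j)"
    unfolding gap_sum_def using assms by (intro sum_mono gap_mono) auto
  also have "\<dots> \<le> gap_sum n'"
    unfolding gap_sum_def using assms by (intro sum_mono2) (auto simp: gap_nonneg)
  finally show ?thesis .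
qed

text \<open>
  Each term is less than half of the one before it, so the tail is at most twice its first term
  \<open>1 / 12!\<close>.
\<close>
lemma sum_inverse_fact_tail:
  "3 \<le> N \<Longrightarrow> (\<Sum>j = 4..N. 1 / fact (3 * j)) \<le> 1 / (10 ^ 8 :: real)"
proof (cases "N = 3")
  case False
  assume "3 \<le> N"
  with False have "4 \<le> N" by simp
  \<comment> \<open>Subtracting the last summand makes the bound inductive.\<close>
  then have "(\<Sum>j = 4..N. 1 / fact (3 * j)) \<le> 2 / (fact 12 :: real) - 1 / fact (3 * N)"
  proof (induction N rule: dec_induct)
    case (step N)
    have "2 * fact (3 * N) \<le> (fact (3 * Suc N) :: real)"
    proof -
      have "3 * Suc N = Suc (Suc (Suc (3 * N)))" by simp
      then have "fact (3 * Suc N) = (3 * real N + 3) * (3 * real N + 2) * (3 * real N + 1) * fact (3 * N)"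
        by (simp only: fact_Suc) (simp add: algebra_simps)
      moreover have "(2::real) \<le> (3 * real N + 3) * (3 * real N + 2) * (3 * real N + 1)"
        by (simp add: algebra_simps)
      ultimately show ?thesis by (simp only: mult_right_mono fact_ge_zero)
    qed
    then have "2 / fact (3 * Suc N) \<le> (1 / fact (3 * N) :: real)"
      by (simp add: divide_simps del: fact_Suc mult_Suc_right)
    then show ?case
      using step by (simp del: fact_Suc mult_Suc_right)
  qed simp
  also have "\<dots> \<le> 2 / fact 12" by simp
  also have "\<dots> \<le> 1 / 10 ^ 8" by (simp add: fact_numeral)
  finally show ?thesis .
qed simp

text \<open>
  Three terms are the right precision: the reciprocal of \<open>gap_sum\<close> crosses \<open>8\<close> between \<open>n = 223\<close>
  and \<open>n = 224\<close>, where \<open>gap_sum\<close> differs from \<open>1 / 8\<close> by about \<open>4 / 10 ^ 6\<close> and \<open>1.3 / 10 ^ 6\<close>. The third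
  term is about \<open>2 / 10 ^ 6\<close> there, and all further ones together are below \<open>1 / 10 ^ 8\<close>.
\<close>
definition gap_head :: "nat \<Rightarrow> real" where
  "gap_head n = gap n 1 + gap n 2 + gap n 3"

lemma gap_sum_split:
  assumes "3 \<le> n"
  shows "gap_sum n = gap_head n + (\<Sum>j = 4..n. gap n j)"
proof -
  have "{1..n} = {1, 2, 3} \<union> {4..n}" using assms by auto
  then show ?thesis by (simp add: gap_sum_def gap_head_def sum.union_disjoint)
qed

lemma gap_head_le_gap_sum: "3 \<le> n \<Longrightarrow> gap_head n \<le> gap_sum n"
  by (simp add: gap_sum_split sum_nonneg gap_nonneg)

lemma gap_sum_le_gap_head: "3 \<le> n \<Longrightarrow> gap_sum n \<le> gap_head n + 1 / 10 ^ 8"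
  using sum_mono[of "{4..n}" "gap n" "\<lambda>j. 1 / fact (3 * j)"] sum_inverse_fact_tail[of n]
  by (simp add: gap_sum_split gap_le)

lemma gap_head_eq:
  assumes "0 < n"
  shows "gap_head n = (1 + 1 / real n) * (1 - 1 / real n) * (1 - 2 / real n) *
    (1 / 8 + (1 - 3 / real n) * (1 - 4 / real n) * (1 - 5 / real n) *
      (1 / 840 + (1 - 6 / real n) * (1 - 7 / real n) * (1 - 8 / real n) / 403200))"
proof -
  have r3: "rise_prob n 3 = (1 - 1 / real n) * (1 - 2 / real n) / 6"
    using assms by (simp add: rise_prob_Suc eval_nat_numeral)
  have r6: "rise_prob n 6 = rise_prob n 3 * ((1 - 3 / real n) * (1 - 4 / real n) * (1 - 5 / real n) / 120)"
    using assms by (simp add: rise_prob_Suc eval_nat_numeral)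
  have r9: "rise_prob n 9 = rise_prob n 6 * ((1 - 6 / real n) * (1 - 7 / real n) * (1 - 8 / real n) / 504)"
    using assms by (simp add: rise_prob_Suc eval_nat_numeral)
  have collect: "3/4 * (a * b / 6 * c) + 6/7 * (a * b / 6 * (p / 120) * c)
      + 9/10 * (a * b / 6 * (p / 120) * (q / 504) * c)
      = c * a * b * (1 / 8 + p * (1 / 840 + q / 403200))" for a b c p q :: real
    by (simp add: algebra_simps)
  have "gap n 1 = 3/4 * (rise_prob n 3 * (1 + 1 / real n))"
       "gap n 2 = 6/7 * (rise_prob n 6 * (1 + 1 / real n))"
       "gap n 3 = 9/10 * (rise_prob n 9 * (1 + 1 / real n))"
    using assms by (simp_all add: gap_eq)
  then show ?thesis
    unfolding gap_head_def by (simp only: r9 r6 r3 collect)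
qed

text \<open>
  The cases are the maximal ranges of \<open>n\<close> on which the integer part \<open>k\<close> of \<open>1 / gap_sum n\<close> is
  constant. By monotonicity each range needs only a lower bound at its left end and an upper bound
  at its right end.
\<close>
lemma gap_sum_between_unit_fractions:
  assumes "4 \<le> n"
  shows "\<exists>k::nat. 0 < k \<and> 1 / real (Suc k) < gap_sum n \<and> gap_sum n < 1 / real k"
proof -
  have mono: "gap_head a \<le> gap_sum n" "gap_sum n \<le> gap_head b + 1 / 10 ^ 8"
    if "3 \<le> a" "a \<le> n" "n \<le> b" for a b
    using that gap_head_le_gap_sum[of a] gap_sum_le_gap_head[of b] gap_sum_mono[of a n] gap_sum_mono[of n b] by auto
  consider "n = 4" | "n = 5" | "n = 6" | "n = 7" | "8 \<le> n" "n \<le> 10" | "11 \<le> n" "n \<le> 17"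
    | "18 \<le> n" "n \<le> 223" | "224 \<le> n" using assms by linarith
  then show ?thesis
  proof cases
    case 1
    then show ?thesis using mono[of 4 4] by (intro exI[of _ 17]) (simp add: gap_head_eq)
  next
    case 2
    then show ?thesis using mono[of 5 5] by (intro exI[of _ 13]) (simp add: gap_head_eq)
  next
    case 3
    then show ?thesis using mono[of 6 6] by (intro exI[of _ 12]) (simp add: gap_head_eq)
  next
    case 4
    then show ?thesis using mono[of 7 7] by (intro exI[of _ 11]) (simp add: gap_head_eq)
  next
    case 5
    then show ?thesis using mono[of 8 10] by (intro exI[of _ 10]) (simp add: gap_head_eq)
  next
    case 6
    then show ?thesis using mono[of 11 17] by (intro exI[of _ 9]) (simp add: gap_head_eq)
  next
    case 7
    then show ?thesis using mono[of 18 223] by (intro exI[of _ 8]) (simp add: gap_head_eq)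
  next
    case 8
    \<comment> \<open>There is no right end, so each term is bounded uniformly in \<open>n \<ge> 224\<close>.\<close>
    have "gap n 1 = 3/4 * (rise_prob n 3 * (1 + 1 / real n))"
      using 8 by (simp add: gap_eq)
    also have "\<dots> \<le> 3/4 * (1/6 * (1 + 1 / 224))"
      using 8 rise_prob_le[of n 3]
      by (intro mult_left_mono mult_mono add_left_mono) (auto simp: fact_numeral rise_prob_nonneg field_simps)
    finally have "gap_head n \<le> 3/4 * (1/6 * (1 + 1 / 224)) + 1/720 + 1/362880"
      using gap_le[of n 2] gap_le[of n 3] 8 by (simp add: gap_head_def fact_numeral)
    then show ?thesis using mono[of 224 n] 8
      by (intro exI[of _ 7]) (simp add: gap_head_eq[of 224])
  qed
qed

lemma gap_sum_3: "gap_sum 3 = 1 / 27"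
proof -
  have "gap 3 2 = 0" "gap 3 3 = 0" by (auto simp: gap_def rise_prob_eq_0)
  then show ?thesis by (simp add: gap_sum_split gap_head_def gap_eq rise_prob_def binomial_eq_0)
qed

section \<open>Runs in a sequence of rolls\<close>

definition avoids :: "(nat \<Rightarrow> nat) \<Rightarrow> nat \<Rightarrow> bool" where
  "avoids x s \<longleftrightarrow> (\<forall>t\<le>s. \<not> three_increasing_at x t)"

text \<open>Only the \<open>m\<close> entries at the positions \<open>s + 1, \<dots>, s + m\<close> are compared.\<close>
definition rises :: "(nat \<Rightarrow> nat) \<Rightarrow> nat \<Rightarrow> nat \<Rightarrow> bool" where
  "rises x s m \<longleftrightarrow> (\<forall>i. s < i \<and> i < s + m \<longrightarrow> x i < x (Suc i))"

text \<open>
  The entry at \<open>s + 1\<close> opens a new run, either because nothing precedes it or because there is no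
  ascent from \<open>s\<close> to \<open>s + 1\<close>. The run may be longer than the \<open>m\<close> entries prescribed here.
\<close>
definition run_starts :: "(nat \<Rightarrow> nat) \<Rightarrow> nat \<Rightarrow> nat \<Rightarrow> bool" where
  "run_starts x s m \<longleftrightarrow> avoids x s \<and> (s = 0 \<or> x (Suc s) \<le> x s) \<and> rises x s m"

lemma avoids_0 [simp]: "avoids x 0"
  by (simp add: avoids_def three_increasing_at_def)

lemma avoids_Suc: "avoids x (Suc s) \<longleftrightarrow> avoids x s \<and> \<not> three_increasing_at x (Suc s)"
  by (auto simp: avoids_def le_Suc_eq)

lemma avoids_mono: "avoids x t \<Longrightarrow> s \<le> t \<Longrightarrow> avoids x s"
  by (auto simp: avoids_def)

lemma three_increasing_at_Suc_iff:
  "three_increasing_at x (Suc s) \<longleftrightarrow> 2 \<le> s \<and> x (s - 1) < x s \<and> x s < x (Suc s)"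
  by (auto simp: three_increasing_at_def numeral_3_eq_3 numeral_2_eq_2)

lemma rises_1 [simp]: "rises x s (Suc 0)"
  by (simp add: rises_def)

lemma rises_Suc_Suc:
  "rises x s (Suc (Suc m)) \<longleftrightarrow> x (Suc s) < x (Suc (Suc s)) \<and> rises x (Suc s) (Suc m)"
  unfolding rises_def by (auto, metis Suc_lessI)

text \<open>
  If there is no ascent into position \<open>s + 1\<close>, a run starts there. Otherwise the run reaches back
  one or two positions; a third one would complete the pattern by time \<open>s\<close>. In the converse
  direction, the run covers at most the positions \<open>s - 1\<close> and \<open>s\<close> of the first \<open>s\<close>, and the
  start of the run prevents the pattern from ending there.
\<close>
lemma avoids_rises_iff:
  assumes "0 < m"
  shows "avoids x s \<and> rises x s m \<longleftrightarrow>
    run_starts x s m \<or> (\<exists>r. s = Suc r \<and> run_starts x r (Suc m)) \<or>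
    (\<exists>r. s = Suc (Suc r) \<and> run_starts x r (Suc (Suc m)))"
proof -
  obtain k where m: "m = Suc k" using assms gr0_conv_Suc by blast
  consider "s = 0" | "s = Suc 0" | r where "s = Suc (Suc r)"
    by (metis not0_implies_Suc)
  then show ?thesis
    by cases (auto simp: m run_starts_def avoids_Suc three_increasing_at_Suc_iff rises_Suc_Suc)
qed

lemma run_starts_disjoint:
  assumes "0 < m"
  shows "\<not> (run_starts x (Suc r) m \<and> run_starts x r (Suc m))"
    and "\<not> (run_starts x (Suc (Suc r)) m \<and> run_starts x r (Suc (Suc m)))"
proof -
  obtain k where m: "m = Suc k" using assms gr0_conv_Suc by blast
  show "\<not> (run_starts x (Suc r) m \<and> run_starts x r (Suc m))"
    "\<not> (run_starts x (Suc (Suc r)) m \<and> run_starts x r (Suc (Suc m)))"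
    by (auto simp: m run_starts_def rises_Suc_Suc)
qed

text \<open>
  A run of three that starts right after a pattern-free prefix of length \<open>s\<close> is exactly a first
  occurrence of the pattern at time \<open>s + 3\<close>.
\<close>
lemma avoids_cases_last_step:
  "avoids x (s + 2) \<longleftrightarrow> avoids x (s + 3) \<or> run_starts x s 3"
  "\<not> (avoids x (s + 3) \<and> run_starts x s 3)"
  by (auto simp: run_starts_def avoids_Suc three_increasing_at_Suc_iff rises_Suc_Suc
       numeral_3_eq_3 numeral_2_eq_2)

lemma less_waiting_time_iff: "enat t < waiting_time x \<longleftrightarrow> avoids x t"
proof (cases "\<exists>t. three_increasing_at x t")
  case True
  then have "t < (LEAST t. three_increasing_at x t) \<longleftrightarrow> avoids x t"
    unfolding avoids_def
    by (metis (mono_tags, lifting) LeastI Least_le linorder_not_less order.trans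
        not_less_Least order_le_less_trans)
  with True show ?thesis by (simp add: waiting_time_def)
next
  case False
  then show ?thesis by (simp add: waiting_time_def avoids_def)
qed

text \<open>
  Stating which positions a property reads gives its measurability, and the independence of
  properties that read disjoint positions, once and for all.
\<close>
definition depends_on :: "nat set \<Rightarrow> ((nat \<Rightarrow> nat) \<Rightarrow> bool) \<Rightarrow> bool" where
  "depends_on I Q \<longleftrightarrow> (\<forall>x y. (\<forall>i\<in>I. x i = y i) \<longrightarrow> Q x = Q y)"

lemma depends_onI: "(\<And>x y. (\<And>i. i \<in> I \<Longrightarrow> x i = y i) \<Longrightarrow> Q x = Q y) \<Longrightarrow> depends_on I Q"
  unfolding depends_on_def by blast

lemma depends_on_mono: "depends_on I Q \<Longrightarrow> I \<subseteq> J \<Longrightarrow> depends_on J Q"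
  unfolding depends_on_def by blast

lemma depends_on_disj:
  "depends_on I Q \<Longrightarrow> depends_on I R \<Longrightarrow> depends_on I (\<lambda>x. Q x \<or> R x)"
  unfolding depends_on_def by blast

lemma depends_on_conj:
  "depends_on I Q \<Longrightarrow> depends_on I R \<Longrightarrow> depends_on I (\<lambda>x. Q x \<and> R x)"
  unfolding depends_on_def by blast

lemma depends_on_avoids: "depends_on {1..s} (\<lambda>x. avoids x s)"
proof (rule depends_onI)
  fix x y :: "nat \<Rightarrow> nat" assume eq: "\<And>i. i \<in> {1..s} \<Longrightarrow> x i = y i"
  have "three_increasing_at x t = three_increasing_at y t" if "t \<le> s" for t
  proof (cases "3 \<le> t")
    case True
    then have "x t = y t" "x (t - 1) = y (t - 1)" "x (t - 2) = y (t - 2)"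
      using that by (auto intro!: eq)
    then show ?thesis by (simp add: three_increasing_at_def)
  qed (simp add: three_increasing_at_def)
  then show "avoids x s = avoids y s" by (auto simp: avoids_def)
qed

lemma depends_on_rises: "depends_on {s + 1..s + m} (\<lambda>x. rises x s m)"
  by (rule depends_onI) (auto simp: rises_def)

lemma depends_on_run_starts:
  assumes "0 < m"
  shows "depends_on {1..s + m} (\<lambda>x. run_starts x s m)"
proof (rule depends_onI)
  fix x y :: "nat \<Rightarrow> nat" assume eq: "\<And>i. i \<in> {1..s + m} \<Longrightarrow> x i = y i"
  then have "avoids x s = avoids y s" "rises x s m = rises y s m"
    using depends_on_avoids[of s] depends_on_rises[of s m] unfolding depends_on_def by auto
  moreover have "x (Suc s) = y (Suc s)" using eq[of "Suc s"] assms by simp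
  moreover have "s = 0 \<or> x s = y s" by (cases "s = 0") (auto intro!: eq)
  ultimately show "run_starts x s m = run_starts y s m" by (auto simp: run_starts_def)
qed

definition block :: "(nat \<Rightarrow> nat) \<Rightarrow> nat \<Rightarrow> nat \<Rightarrow> nat list" where
  "block x s m = map (\<lambda>i. x (Suc (s + i))) [0..<m]"

lemma length_block [simp]: "length (block x s m) = m"
  by (simp add: block_def)

lemma nth_block [simp]: "i < m \<Longrightarrow> block x s m ! i = x (Suc (s + i))"
  by (simp add: block_def)

lemma depends_on_block: "depends_on {s + 1..s + m} (\<lambda>x. Q (block x s m))"
proof (rule depends_onI)
  fix x y :: "nat \<Rightarrow> nat" assume "\<And>i. i \<in> {s + 1..s + m} \<Longrightarrow> x i = y i"
  then have "block x s m = block y s m" by (simp add: block_def)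
  then show "Q (block x s m) = Q (block y s m)" by simp
qed

text \<open>Neighbouring comparisons suffice because \<open><\<close> is transitive.\<close>
lemma rises_iff_sorted_wrt_block: "rises x s m \<longleftrightarrow> sorted_wrt (<) (block x s m)"
proof -
  have "sorted_wrt (<) (block x s m) \<longleftrightarrow> (\<forall>i. Suc i < m \<longrightarrow> x (Suc (s + i)) < x (Suc (s + Suc i)))"
    by (auto simp: sorted_wrt_iff_nth_Suc_transp[OF transp_on_less])
  also have "\<dots> \<longleftrightarrow> rises x s m"
    unfolding rises_def
  proof safe
    fix i assume *: "\<forall>i. Suc i < m \<longrightarrow> x (Suc (s + i)) < x (Suc (s + Suc i))" "s < i" "i < s + m"
    then obtain j where "i = Suc (s + j)" using less_imp_Suc_add by blast
    with * show "x i < x (Suc i)" by simp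
  qed auto
  finally show ?thesis by simp
qed

section \<open>Probabilities of events of independent die rolls\<close>

locale die_rolls = prob_space M for M :: "'a measure" +
  fixes n :: nat and X :: "nat \<Rightarrow> 'a \<Rightarrow> nat"
  assumes n_pos: "0 < n"
    and indep: "indep_vars (\<lambda>_. count_space UNIV) X {1..}"
    and distr_X: "1 \<le> i \<Longrightarrow> distr M (count_space UNIV) (X i) = measure_pmf (pmf_of_set {1..n})"
begin

definition roll_prob :: "((nat \<Rightarrow> nat) \<Rightarrow> bool) \<Rightarrow> real" where
  "roll_prob Q = prob {\<omega> \<in> space M. Q (\<lambda>i. X i \<omega>)}"

lemma measurable_X [measurable]: "1 \<le> i \<Longrightarrow> X i \<in> measurable M (count_space UNIV)"
  using indep unfolding indep_vars_def by auto

text \<open>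
  The event is pulled back from a finite product of copies of \<open>nat\<close>, which is a discrete space, so
  that every property of finitely many rolls becomes measurable.
\<close>
lemma event_eq_vimage:
  assumes "depends_on I Q"
  shows "{\<omega> \<in> space M. Q (\<lambda>i. X i \<omega>)} =
    (\<lambda>\<omega>. restrict (\<lambda>i. X i \<omega>) I) -` {f \<in> I \<rightarrow>\<^sub>E UNIV. Q f} \<inter> space M"
proof -
  have "Q (restrict (\<lambda>i. X i \<omega>) I) = Q (\<lambda>i. X i \<omega>)" for \<omega>
    using assms unfolding depends_on_def by (metis restrict_apply')
  then show ?thesis by auto
qed

lemma PiM_count_space:
  "finite I \<Longrightarrow> PiM I (\<lambda>_::nat. count_space (UNIV :: nat set)) = count_space (I \<rightarrow>\<^sub>E UNIV)"
  by (rule count_space_PiM_finite) auto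

lemma event_if_depends_on:
  assumes "depends_on I Q" "finite I" "I \<subseteq> {1..}"
  shows "{\<omega> \<in> space M. Q (\<lambda>i. X i \<omega>)} \<in> events"
proof -
  have "(\<lambda>\<omega>. restrict (\<lambda>i. X i \<omega>) I) \<in> measurable M (PiM I (\<lambda>_. count_space UNIV))"
    using assms(3) by (intro measurable_restrict measurable_X) auto
  then show ?thesis
    unfolding event_eq_vimage[OF assms(1)] PiM_count_space[OF assms(2)]
    by (rule measurable_sets) auto
qed

lemma roll_prob_indep:
  assumes "depends_on I Q" "depends_on J R" "finite I" "finite J" "I \<subseteq> {1..}" "J \<subseteq> {1..}" "I \<inter> J = {}"
  shows "roll_prob (\<lambda>x. Q x \<and> R x) = roll_prob Q * roll_prob R"
proof -
  define Y where "Y I \<omega> = restrict (\<lambda>i. X i \<omega>) I" for I \<omega>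
  define S where "S I Q = {f \<in> I \<rightarrow>\<^sub>E (UNIV :: nat set). Q f}" for I :: "nat set" and Q
  have "indep_var (PiM I (\<lambda>_. count_space UNIV)) (Y I) (PiM J (\<lambda>_. count_space UNIV)) (Y J)"
    unfolding Y_def using assms(5-7) by (intro indep_var_restrict[OF indep]) auto
  then have "indep_var (count_space (I \<rightarrow>\<^sub>E UNIV)) (Y I) (count_space (J \<rightarrow>\<^sub>E UNIV)) (Y J)"
    by (simp add: PiM_count_space assms(3,4))
  from indep_varD[OF this, of "S I Q" "S J R"]
  have "prob ((\<lambda>\<omega>. (Y I \<omega>, Y J \<omega>)) -` (S I Q \<times> S J R) \<inter> space M)
      = prob (Y I -` S I Q \<inter> space M) * prob (Y J -` S J R \<inter> space M)"
    by (auto simp: S_def)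
  moreover have Q: "{\<omega> \<in> space M. Q (\<lambda>i. X i \<omega>)} = Y I -` S I Q \<inter> space M"
    and R: "{\<omega> \<in> space M. R (\<lambda>i. X i \<omega>)} = Y J -` S J R \<inter> space M"
    using event_eq_vimage assms(1,2) unfolding Y_def S_def by blast+
  moreover have "{\<omega> \<in> space M. Q (\<lambda>i. X i \<omega>) \<and> R (\<lambda>i. X i \<omega>)}
      = (\<lambda>\<omega>. (Y I \<omega>, Y J \<omega>)) -` (S I Q \<times> S J R) \<inter> space M"
    using Q R by blast
  ultimately show ?thesis by (simp add: roll_prob_def)
qed

lemma roll_prob_disj:
  assumes "depends_on I Q" "depends_on I R" "finite I" "I \<subseteq> {1..}" "\<And>x. \<not> (Q x \<and> R x)"
  shows "roll_prob (\<lambda>x. Q x \<or> R x) = roll_prob Q + roll_prob R"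
proof -
  have "{\<omega> \<in> space M. Q (\<lambda>i. X i \<omega>) \<or> R (\<lambda>i. X i \<omega>)} =
      {\<omega> \<in> space M. Q (\<lambda>i. X i \<omega>)} \<union> {\<omega> \<in> space M. R (\<lambda>i. X i \<omega>)}" by auto
  then show ?thesis
    unfolding roll_prob_def using assms event_if_depends_on by (auto intro!: finite_measure_Union)
qed

lemma roll_prob_mono:
  assumes "depends_on I R" "finite I" "I \<subseteq> {1..}" "\<And>x. Q x \<Longrightarrow> R x"
  shows "roll_prob Q \<le> roll_prob R"
  unfolding roll_prob_def using assms event_if_depends_on by (intro finite_measure_mono) auto

lemma prob_X_eq:
  assumes "1 \<le> i" "k \<in> {1..n}"
  shows "prob (X i -` {k} \<inter> space M) = 1 / real n"
proof -
  have "prob (X i -` {k} \<inter> space M) = measure (distr M (count_space UNIV) (X i)) {k}"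
    using assms by (subst measure_distr) auto
  also have "\<dots> = 1 / real n"
    using assms by (simp add: distr_X measure_pmf_single)
  finally show ?thesis .
qed

lemma AE_X_range:
  assumes "1 \<le> i"
  shows "AE \<omega> in M. X i \<omega> \<in> {1..n}"
proof -
  have "AE k in distr M (count_space UNIV) (X i). k \<in> {1..n}"
    unfolding distr_X[OF assms] AE_measure_pmf_iff using n_pos by simp
  then show ?thesis using assms by (subst (asm) AE_distr_iff) auto
qed

lemma prob_block_eq:
  assumes "set w \<subseteq> {1..n}" "w \<noteq> []"
  shows "prob {\<omega> \<in> space M. block (\<lambda>i. X i \<omega>) s (length w) = w} = (1 / real n) ^ length w"
proof -
  define I where "I = (\<lambda>j. Suc (s + j)) ` {..<length w}"
  have I: "I \<noteq> {}" "finite I" "I \<subseteq> {1..}" "card I = length w"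
    using assms by (auto simp: I_def card_image inj_on_def)
  have block_iff: "block f s (length w) = w \<longleftrightarrow> (\<forall>i\<in>I. f i = w ! (i - Suc s))" for f
    by (auto simp: I_def list_eq_iff_nth_eq)
  have "{\<omega> \<in> space M. block (\<lambda>i. X i \<omega>) s (length w) = w}
      = (\<Inter>i\<in>I. X i -` {w ! (i - Suc s)} \<inter> space M)"
    using I(1) by (auto simp: block_iff)
  also have "prob \<dots> = (\<Prod>i\<in>I. prob (X i -` {w ! (i - Suc s)} \<inter> space M))"
    using I by (intro indep_varsD_finite[OF indep_vars_subset[OF indep I(3)]]) auto
  also have "\<dots> = (\<Prod>i\<in>I. 1 / real n)"
  proof (intro prod.cong refl prob_X_eq)
    fix i assume "i \<in> I"
    then have "w ! (i - Suc s) \<in> set w" by (auto simp: I_def)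
    then show "w ! (i - Suc s) \<in> {1..n}" using assms(1) by blast
  qed (auto simp: I_def)
  finally show ?thesis by (simp add: I)
qed

end

text \<open>A strictly sorted list is determined by its set of entries.\<close>
lemma card_strict_sorted_lists:
  assumes "finite (A :: nat set)"
  shows "finite {w. sorted_wrt (<) w \<and> set w \<subseteq> A \<and> length w = m}"
    "card {w. sorted_wrt (<) w \<and> set w \<subseteq> A \<and> length w = m} = card A choose m"
proof -
  let ?L = "{w. sorted_wrt (<) w \<and> set w \<subseteq> A \<and> length w = m}"
  have "bij_betw set ?L {S. S \<subseteq> A \<and> card S = m}"
  proof (rule bij_betwI[where g = sorted_list_of_set])
    show "set \<in> ?L \<rightarrow> {S. S \<subseteq> A \<and> card S = m}"
      by (auto simp: distinct_card strict_sorted_iff)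
    have "sorted_list_of_set S \<in> ?L" if "S \<subseteq> A" "card S = m" for S
      using that finite_subset[OF that(1) assms] by simp
    then show "sorted_list_of_set \<in> {S. S \<subseteq> A \<and> card S = m} \<rightarrow> ?L" by blast
    show "sorted_list_of_set (set w) = w" if "w \<in> ?L" for w
      using that by (simp add: strict_sorted_iff sorted_list_of_set.idem_if_sorted_distinct)
    show "set (sorted_list_of_set S) = S" if "S \<in> {S. S \<subseteq> A \<and> card S = m}" for S
      using that finite_subset[OF _ assms] by auto
  qed
  from bij_betw_same_card[OF this] show "card ?L = card A choose m"
    by (simp only: n_subsets[OF assms])
  show "finite ?L"
    using finite_lists_length_eq[OF assms, of m] by (rule rev_finite_subset) auto
qed

context die_rolls begin

text \<open>
  Each of the \<open>n choose m\<close> increasing words over \<open>{1..n}\<close> has probability \<open>1 / n ^ m\<close>. Rolls outside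
  \<open>{1..n}\<close> are possible on a null set, hence the detour through almost everywhere equality.
\<close>
lemma roll_prob_rises:
  assumes "0 < m"
  shows "roll_prob (\<lambda>x. rises x s m) = rise_prob n m"
proof -
  let ?W = "\<lambda>\<omega>. block (\<lambda>i. X i \<omega>) s m"
  let ?L = "{w. sorted_wrt (<) w \<and> set w \<subseteq> {1..n} \<and> length w = m}"
  have event_block: "{\<omega> \<in> space M. Q (?W \<omega>)} \<in> events" for Q
    by (rule event_if_depends_on[OF depends_on_block]) auto
  have "AE \<omega> in M. \<forall>i<m. X (Suc (s + i)) \<omega> \<in> {1..n}"
    using AE_X_range by (subst AE_all_countable, intro allI AE_impI) auto
  then have "AE \<omega> in M. (\<omega> \<in> {\<omega> \<in> space M. rises (\<lambda>i. X i \<omega>) s m}) = (\<omega> \<in> {\<omega> \<in> space M. ?W \<omega> \<in> ?L})"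
    by eventually_elim (auto simp: rises_iff_sorted_wrt_block block_def)
  then have "roll_prob (\<lambda>x. rises x s m) = prob {\<omega> \<in> space M. ?W \<omega> \<in> ?L}"
    unfolding roll_prob_def by (rule measure_eq_AE[OF _ event_if_depends_on[OF depends_on_rises] event_block]) auto
  also have "{\<omega> \<in> space M. ?W \<omega> \<in> ?L} = (\<Union>w\<in>?L. {\<omega> \<in> space M. ?W \<omega> = w})" by auto
  also have "prob \<dots> = (\<Sum>w\<in>?L. prob {\<omega> \<in> space M. ?W \<omega> = w})"
  proof (rule finite_measure_finite_Union)
    show "finite ?L" by (simp add: card_strict_sorted_lists)
    show "(\<lambda>w. {\<omega> \<in> space M. ?W \<omega> = w}) ` ?L \<subseteq> events"
      by (intro image_subsetI event_block)
    show "disjoint_family_on (\<lambda>w. {\<omega> \<in> space M. ?W \<omega> = w}) ?L"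
      unfolding disjoint_family_on_def by blast
  qed
  also have "\<dots> = (\<Sum>w\<in>?L. (1 / real n) ^ m)"
    using prob_block_eq[of _ s] assms by (intro sum.cong) auto
  also have "\<dots> = rise_prob n m"
    by (simp add: card_strict_sorted_lists rise_prob_def power_one_over field_simps)
  finally show ?thesis .
qed

section \<open>The expected waiting time\<close>

definition run_start_prob :: "nat \<Rightarrow> nat \<Rightarrow> real" where
  "run_start_prob s m = roll_prob (\<lambda>x. run_starts x s m)"

definition survival :: "nat \<Rightarrow> real" where
  "survival s = roll_prob (\<lambda>x. avoids x s)"

text \<open>Avoiding the pattern up to \<open>s\<close> and rising after \<open>s\<close> concern disjoint sets of rolls.\<close>
lemma survival_mult_rise_prob:
  assumes "0 < m"
  shows "survival s * rise_prob n m = roll_prob (\<lambda>x. avoids x s \<and> rises x s m)"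
  unfolding survival_def roll_prob_rises[OF assms, of s, symmetric]
  by (rule roll_prob_indep[OF depends_on_avoids depends_on_rises, symmetric]) auto

text \<open>
  The probability form of the decomposition by the start of the current run; for \<open>s < 2\<close>
  the start positions before the first roll drop out.
\<close>
lemma survival_mult_rise_prob_eq:
  assumes "0 < m"
  shows "survival s * rise_prob n m =
    run_start_prob s m + (case s of 0 \<Rightarrow> 0 | Suc r \<Rightarrow> run_start_prob r (Suc m) +
    (case r of 0 \<Rightarrow> 0 | Suc r \<Rightarrow> run_start_prob r (Suc (Suc m))))"
proof -
  have dep: "depends_on {1..s + m} (\<lambda>x. run_starts x r (s + m - r))" if "r \<le> s" for r
    using depends_on_run_starts[of "s + m - r" r] that assms by simp
  note iff = avoids_rises_iff[OF assms, of _ s]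
  note disj = run_starts_disjoint[OF assms] run_starts_disjoint(1)[of "Suc m"]
  consider "s = 0" | "s = Suc 0" | r where "s = Suc (Suc r)"
    by (metis not0_implies_Suc)
  then show ?thesis
  proof cases
    case 1
    then show ?thesis using iff by (simp add: survival_mult_rise_prob assms run_start_prob_def)
  next
    case 2
    have "roll_prob (\<lambda>x. run_starts x 1 m \<or> run_starts x 0 (Suc m)) = run_start_prob 1 m + run_start_prob 0 (Suc m)"
      unfolding run_start_prob_def using 2 dep[of 0] dep[of 1] disj(1)[of _ 0]
      by (intro roll_prob_disj[where I = "{1..s + m}"]) auto
    then show ?thesis using iff 2 by (simp add: survival_mult_rise_prob assms)
  next
    case (3 r)
    have dep2: "depends_on {1..s + m} (\<lambda>x. run_starts x (Suc r) (Suc m))"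
      "depends_on {1..s + m} (\<lambda>x. run_starts x r (Suc (Suc m)))"
      using dep[of "Suc r"] dep[of r] 3 by auto
    have "roll_prob (\<lambda>x. run_starts x s m \<or> (run_starts x (Suc r) (Suc m) \<or> run_starts x r (Suc (Suc m))))
      = run_start_prob s m + roll_prob (\<lambda>x. run_starts x (Suc r) (Suc m) \<or> run_starts x r (Suc (Suc m)))"
      unfolding run_start_prob_def using 3 dep[of s] depends_on_disj[OF dep2] disj(1)[of _ "Suc r"] disj(2)[of _ r]
      by (intro roll_prob_disj[where I = "{1..s + m}"]) auto
    also have "roll_prob (\<lambda>x. run_starts x (Suc r) (Suc m) \<or> run_starts x r (Suc (Suc m)))
      = run_start_prob (Suc r) (Suc m) + run_start_prob r (Suc (Suc m))"
      unfolding run_start_prob_def using dep2 disj(3)[of _ r]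
      by (intro roll_prob_disj[where I = "{1..s + m}"]) auto
    finally show ?thesis using iff 3 by (simp add: survival_mult_rise_prob assms)
  qed
qed

lemma run_start_prob_nonneg: "0 \<le> run_start_prob s m" by (simp add: run_start_prob_def roll_prob_def)
lemma survival_nonneg: "0 \<le> survival s" by (simp add: survival_def roll_prob_def)
lemma survival_le_1: "survival s \<le> 1" by (simp add: survival_def roll_prob_def)

lemma run_start_prob_le_rise_prob: "0 < m \<Longrightarrow> run_start_prob s m \<le> rise_prob n m"
  unfolding run_start_prob_def roll_prob_rises[of m s, symmetric]
  by (rule roll_prob_mono[OF depends_on_rises]) (auto simp: run_starts_def)

lemma run_start_prob_le_survival: "run_start_prob s m \<le> survival s"
  unfolding run_start_prob_def survival_def
  by (rule roll_prob_mono[OF depends_on_avoids]) (auto simp: run_starts_def)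

lemma run_start_prob_3: "run_start_prob s 3 = survival (s + 2) - survival (s + 3)"
proof -
  have "roll_prob (\<lambda>x. avoids x (s + 3) \<or> run_starts x s 3) = survival (s + 3) + run_start_prob s 3"
    unfolding survival_def run_start_prob_def
    using depends_on_avoids[of "s + 3"] depends_on_run_starts[of 3 s] avoids_cases_last_step(2)
    by (intro roll_prob_disj[where I = "{1..s + 3}"]) auto
  then show ?thesis unfolding avoids_cases_last_step(1)[symmetric] by (simp add: survival_def)
qed

text \<open>
  Whatever happened up to time \<open>s\<close>, the next three rolls increase with probability
  \<open>rise_prob n 3\<close> and then end the wait. So \<open>rise_prob n 3 * survival s\<close> is at most
  \<open>survival s - survival (s + 3)\<close>, and these differences telescope. The assumption \<open>n \<ge> 3\<close> makes
  \<open>rise_prob n 3\<close> positive.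
\<close>
lemma summable_survival:
  assumes "3 \<le> n"
  shows "summable survival"
proof (rule summableI_nonneg_bounded)
  define q where "q = rise_prob n 3"
  have q: "0 < q" using assms by (simp add: q_def rise_prob_def)
  have drop: "survival s * q \<le> survival s - survival (s + 3)" for s
  proof -
    have "survival s * q + survival (s + 3)
        = roll_prob (\<lambda>x. avoids x s \<and> rises x s 3) + roll_prob (\<lambda>x. avoids x (s + 3))"
      by (simp add: q_def survival_mult_rise_prob) (simp add: survival_def)
    also have "\<dots> = roll_prob (\<lambda>x. (avoids x s \<and> rises x s 3) \<or> avoids x (s + 3))"
    proof (rule roll_prob_disj[where I = "{1..s + 3}", symmetric])
      show "depends_on {1..s + 3} (\<lambda>x. avoids x s \<and> rises x s 3)"
        by (rule depends_on_conj[OF depends_on_mono[OF depends_on_avoids] depends_on_mono[OF depends_on_rises]]) auto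
      show "\<not> ((avoids x s \<and> rises x s 3) \<and> avoids x (s + 3))" for x
        by (auto simp: avoids_Suc three_increasing_at_Suc_iff rises_Suc_Suc numeral_3_eq_3)
    qed (use depends_on_avoids in auto)
    also have "\<dots> \<le> survival s"
      unfolding survival_def by (rule roll_prob_mono[OF depends_on_avoids]) (use avoids_mono[of _ "s + 3" s] in auto)
    finally show ?thesis by simp
  qed
  show "sum survival {..<N} \<le> 3 / q" for N
  proof -
    have "sum survival {..<N} * q \<le> (\<Sum>s<N. survival s - survival (s + 3))"
      unfolding sum_distrib_right by (intro sum_mono drop)
    also have "\<dots> = (survival 0 + survival 1 + survival 2)
        - (survival N + survival (N + 1) + survival (N + 2))"
      by (induction N) (auto simp: numeral_3_eq_3 numeral_2_eq_2)
    also have "\<dots> \<le> 3"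
      using survival_le_1[of 0] survival_le_1[of 1] survival_le_1[of 2]
        survival_nonneg[of N] survival_nonneg[of "N + 1"] survival_nonneg[of "N + 2"] by linarith
    finally show ?thesis using q by (simp add: field_simps)
  qed
qed (rule survival_nonneg)

definition run_start_total :: "nat \<Rightarrow> real" where
  "run_start_total m = (\<Sum>s. run_start_prob s m)"

lemma sums_run_start_total: "3 \<le> n \<Longrightarrow> (\<lambda>s. run_start_prob s m) sums run_start_total m"
  unfolding run_start_total_def
  by (intro summable_sums summable_comparison_test'[OF summable_survival])
     (auto simp: run_start_prob_nonneg run_start_prob_le_survival)

text \<open>This is the probability that the pattern occurs at all, split by the time of its first occurrence.\<close>
lemma run_start_total_3_eq_1:
  assumes "3 \<le> n"
  shows "run_start_total 3 = 1"
proof -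
  have "survival \<longlonglongrightarrow> 0" using summable_survival[OF assms] by (rule summable_LIMSEQ_zero)
  then have "(\<lambda>s. survival (s + 2)) \<longlonglongrightarrow> 0" by (rule LIMSEQ_ignore_initial_segment)
  from telescope_sums'[OF this] have "(\<lambda>s. survival (s + 2) - survival (s + 3)) sums survival 2"
    by (simp add: eval_nat_numeral)
  then have "(\<lambda>s. run_start_prob s 3) sums survival 2"
    by (simp only: run_start_prob_3)
  moreover have "avoids x 2" for x
    by (auto simp: avoids_def three_increasing_at_def)
  then have "survival 2 = 1" by (simp add: survival_def roll_prob_def prob_space)
  ultimately show ?thesis using sums_unique2[OF sums_run_start_total[OF assms, of 3]] by simp
qed

text \<open>
  Summing over \<open>s\<close>, the three ways to locate the start of the run contribute shifted copies of the
  series for \<open>m\<close>, \<open>m + 1\<close> and \<open>m + 2\<close>, and a shift by leading zeros keeps the sum.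
\<close>
lemma suminf_survival_mult_rise_prob:
  assumes "3 \<le> n" "0 < m"
  shows "suminf survival * rise_prob n m =
    run_start_total m + run_start_total (Suc m) + run_start_total (Suc (Suc m))"
proof -
  define shift where "shift f s = (case s of 0 \<Rightarrow> 0 | Suc r \<Rightarrow> f r)" for f :: "nat \<Rightarrow> real" and s
  have shift: "f sums l \<Longrightarrow> shift f sums l" for f l
    using sums_Suc[of "shift f" l] by (simp add: shift_def)
  have "(\<lambda>s. run_start_prob s m + shift (\<lambda>r. run_start_prob r (Suc m) +
        shift (\<lambda>r. run_start_prob r (Suc (Suc m))) r) s)
      sums (run_start_total m + (run_start_total (Suc m) + run_start_total (Suc (Suc m))))"
    by (intro sums_add shift sums_run_start_total assms)
  moreover have "(\<lambda>s. survival s * rise_prob n m) sums (suminf survival * rise_prob n m)"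
    by (intro sums_mult2 summable_sums summable_survival assms)
  moreover have "survival s * rise_prob n m =
      run_start_prob s m + shift (\<lambda>r. run_start_prob r (Suc m) +
        shift (\<lambda>r. run_start_prob r (Suc (Suc m))) r) s" for s
    by (simp add: shift_def survival_mult_rise_prob_eq[OF assms(2)])
  ultimately have "suminf survival * rise_prob n m =
      run_start_total m + (run_start_total (Suc m) + run_start_total (Suc (Suc m)))"
    by (simp only: sums_unique2)
  then show ?thesis by simp
qed

text \<open>No strictly increasing run fits more than \<open>n\<close> values, which stops the telescoping sum below.\<close>
lemma run_start_total_eq_0: "n < m \<Longrightarrow> run_start_total m = 0"
proof -
  assume "n < m"
  then have "run_start_prob s m = 0" for s
    using run_start_prob_le_rise_prob[of m s] run_start_prob_nonneg[of s m] by (simp add: rise_prob_def binomial_eq_0)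
  then show ?thesis by (simp add: run_start_total_def)
qed

text \<open>
  The tail-sum formula. Measurability of the waiting time is recovered from its tail events, since
  its values form a countable set.
\<close>
lemma expected_waiting_time_eq:
  assumes "3 \<le> n"
  shows "expected_waiting_time M X = ennreal (suminf survival)"
proof -
  have ev: "{\<omega> \<in> space M. avoids (\<lambda>i. X i \<omega>) t} \<in> events" for t
    by (rule event_if_depends_on[OF depends_on_avoids]) auto
  have less_event: "{\<omega> \<in> space M. enat t < waiting_time (\<lambda>i. X i \<omega>)} \<in> events" for t
    unfolding less_waiting_time_iff by (rule ev)
  have less: "{\<omega> \<in> space M. enat t < waiting_time (\<lambda>i. X i \<omega>)} = {\<omega> \<in> space M. avoids (\<lambda>i. X i \<omega>) t}" for t
    by (simp add: less_waiting_time_iff)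
  have enat_eq_iff: "w = enat k \<longleftrightarrow> (\<forall>t<k. enat t < w) \<and> \<not> enat k < w" for w k
    by (cases w) (auto simp: not_less le_less)
  have infinity_iff: "w = \<infinity> \<longleftrightarrow> (\<forall>t. enat t < w)" for w
    by (cases w) auto
  have "(\<lambda>\<omega>. waiting_time (\<lambda>i. X i \<omega>)) \<in> measurable M (count_space UNIV)"
    unfolding measurable_count_space_eq2_countable
  proof (intro conjI ballI)
    fix e :: enat
    show "(\<lambda>\<omega>. waiting_time (\<lambda>i. X i \<omega>)) -` {e} \<inter> space M \<in> events"
    proof (cases e)
      case (enat k)
      have "(\<lambda>\<omega>. waiting_time (\<lambda>i. X i \<omega>)) -` {e} \<inter> space M =
        {\<omega> \<in> space M. (\<forall>t<k. enat t < waiting_time (\<lambda>i. X i \<omega>)) \<and>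
          \<not> enat k < waiting_time (\<lambda>i. X i \<omega>)}"
        by (auto simp: enat enat_eq_iff)
      then show ?thesis
        by (simp only:) (intro sets.sets_Collect less_event)
    next
      case infinity
      have "(\<lambda>\<omega>. waiting_time (\<lambda>i. X i \<omega>)) -` {e} \<inter> space M =
        {\<omega> \<in> space M. \<forall>t. enat t < waiting_time (\<lambda>i. X i \<omega>)}"
        by (auto simp: infinity infinity_iff)
      then show ?thesis
        by (simp only:) (intro sets.sets_Collect less_event)
    qed
  qed simp
  then have "expected_waiting_time M X = (\<Sum>t. emeasure M {\<omega> \<in> space M. enat t < waiting_time (\<lambda>i. X i \<omega>)})"
    unfolding expected_waiting_time_def by (rule nn_integral_enat_function)
  also have "\<dots> = (\<Sum>t. ennreal (survival t))"
    unfolding less survival_def roll_prob_def by (simp add: emeasure_eq_measure)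
  also have "\<dots> = ennreal (suminf survival)"
    by (intro suminf_ennreal2 survival_nonneg summable_survival assms)
  finally show ?thesis .
qed

lemma suminf_survival_mult_gap_sum:
  assumes "3 \<le> n"
  shows "suminf survival * gap_sum n = 1"
proof -
  have gap: "suminf survival * gap n j = run_start_total (3 * j) - run_start_total (3 * Suc j)" if "j \<in> {1..n}" for j
    using that suminf_survival_mult_rise_prob[OF assms, of "3 * j"]
      suminf_survival_mult_rise_prob[OF assms, of "3 * j + 1"]
    by (simp add: gap_def right_diff_distrib numeral_3_eq_3)
  have "suminf survival * gap_sum n = (\<Sum>j = 1..n. run_start_total (3 * j) - run_start_total (3 * Suc j))"
    unfolding gap_sum_def sum_distrib_left by (intro sum.cong refl gap)
  also have "\<dots> = run_start_total (3 * 1) - run_start_total (3 * Suc n)"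
    using assms sum_Suc_diff[of 1 n "\<lambda>j. - run_start_total (3 * j)"] by simp
  also have "\<dots> = 1"
    using run_start_total_eq_0[of "3 * Suc n"] run_start_total_3_eq_1[OF assms] by simp
  finally show ?thesis .
qed

lemma expected_waiting_time_eq_inverse_gap_sum:
  assumes "3 \<le> n"
  shows "expected_waiting_time M X = ennreal (1 / gap_sum n)"
proof -
  have "suminf survival = 1 / gap_sum n"
    using suminf_survival_mult_gap_sum[OF assms]
    by (metis mult_zero_right nonzero_eq_divide_eq zero_neq_one)
  then show ?thesis by (simp only: expected_waiting_time_eq[OF assms])
qed

end

theorem theorem2p22:
  fixes n :: nat and M :: "'a measure" and X :: "nat \<Rightarrow> 'a \<Rightarrow> nat"
  assumes "n \<ge> 3"
    and "iid_die_rolls M n X"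
  shows "expected_waiting_time M X \<in> \<nat> \<longleftrightarrow> n = 3"
proof -
  interpret die_rolls M n X
    using assms by (intro die_rolls.intro die_rolls_axioms.intro) (auto simp: iid_die_rolls_def)
  note E = expected_waiting_time_eq_inverse_gap_sum[OF assms(1)]
  show ?thesis
  proof
    assume "n = 3"
    then have "expected_waiting_time M X = of_nat 27" by (simp add: E gap_sum_3)
    then show "expected_waiting_time M X \<in> \<nat>" by (simp only: of_nat_in_Nats)
  next
    assume "expected_waiting_time M X \<in> \<nat>"
    then obtain j where j: "expected_waiting_time M X = of_nat j" by (elim Nats_cases)
    show "n = 3"
    proof (rule ccontr)
      assume "n \<noteq> 3"
      then have "4 \<le> n" using assms(1) by simp
      then obtain k :: nat where k: "0 < k" "1 / real (Suc k) < gap_sum n" "gap_sum n < 1 / real k"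
        using gap_sum_between_unit_fractions by blast
      have pos: "0 < gap_sum n" using k(2) by (rule less_trans[rotated]) simp
      have "ennreal (1 / gap_sum n) = ennreal (real j)"
        using E j by (simp add: ennreal_of_nat_eq_real_of_nat)
      then have "1 / gap_sum n = real j" using pos by (simp add: ennreal_inj)
      moreover have "real k < 1 / gap_sum n" "1 / gap_sum n < real (Suc k)"
        using k pos by (simp_all add: field_simps)
      ultimately have "k < j" "j < Suc k" by linarith+
      then show False by simp
    qed
  qed
qed

end
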